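(* Let $g\in\mathbb{R}^T$. If $f\in\mathbb{R}^T$ is an optimal solution of the problem $$\min\{\,B(f')\mid f'\in\mathbb{R}^T \text{ is a super-reparametrization of } g\,\},$$ then $\mathrm{OPT}(g)\subseteq\mathrm{OPT}(f)=\mathrm{SOL}(A^*(f))$.
   Context: Fix a structure $(D,V,C)$: $V$ is a finite set of variables, $D$ a finite nonempty domain, $C\subseteq 2^V$ a set of non-empty subsets of $V$ (scopes). For $S\subseteq V$, $D^S$ is the set of maps $S\to D$; for an assignment $x\in D^V$, $x[S]\in D^S$ is its restriction to $S$. Tuples: $T_S=\{(S,k)\mid k\in D^S\}$ for $S\in C$ and $T=\bigcup_{S\in C}T_S$. A CSP is a subset $A\subseteq T$ (of allowed tuples); its solution set is $\mathrm{SOL}(A)=\{x\in D^V\mid (S,x[S])\in A\ \forall S\in C\}$. A WCSP is a vector $f\in\mathbb{R}^T$. The map $\phi\colon D^V\to\{0,1\}^T$ is defined by $\phi_{(S,k)}(x)=1$ if $x[S]=k$ and $0$ otherwise, so the WCSP objective is $\langle f,\phi(x)\rangle=\sum_{S\in C}f_{(S,x[S])}$. $\mathrm{OPT}(f)=\operatorname{argmax}_{x\in D^V}\langle f,\phi(x)\rangle\subseteq D^V$ is the set of optimal assignments. A WCSP $f$ is a super-reparametrization of $g$ if $\langle f,\phi(x)\rangle\ge\langle g,\phi(x)\rangle$ for all $x\in D^V$. Upper bound: $B(f)=\sum_{S\in C}\max_{t\in T_S}f_t$. A tuple $t\in T_S$ is active for $f$ if $f_t=\max_{t'\in T_S}f_{t'}$;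 $A^*(f)\subseteq T$ is the set of all tuples active for $f$, viewed as a CSP. *)

theory Defs
  imports Complex_Main "HOL-Library.FuncSet"
begin

text \<open>
  A structure is given by a domain \<open>D\<close>, a set of variables \<open>V\<close> and a set of scopes \<open>C\<close>.
  The set \<open>D\<^sup>S\<close> of maps from \<open>S\<close> to \<open>D\<close> is the extensional function space \<open>S \<rightarrow>\<^sub>E D\<close>,
  and \<open>x[S]\<close> is \<open>restrict x S\<close>.
\<close>

definition structure_DVC :: "'d set \<Rightarrow> 'v set \<Rightarrow> 'v set set \<Rightarrow> bool" where
  "structure_DVC D V C \<longleftrightarrow> finite V \<and> finite D \<and> D \<noteq> {} \<and> C \<subseteq> Pow V \<and> {} \<notin> C"

type_synonym ('v, 'd) tuple = "'v set \<times> ('v \<Rightarrow> 'd)"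

definition assignments :: "'d set \<Rightarrow> 'v set \<Rightarrow> ('v \<Rightarrow> 'd) set" where
  "assignments D V = (V \<rightarrow>\<^sub>E D)"

definition scope_tuples :: "'d set \<Rightarrow> 'v set \<Rightarrow> ('v, 'd) tuple set" where
  "scope_tuples D S = {(S, k) | k. k \<in> S \<rightarrow>\<^sub>E D}"

definition tuples :: "'d set \<Rightarrow> 'v set set \<Rightarrow> ('v, 'd) tuple set" where
  "tuples D C = (\<Union>S\<in>C. scope_tuples D S)"

definition SOL :: "'d set \<Rightarrow> 'v set \<Rightarrow> 'v set set \<Rightarrow> ('v, 'd) tuple set \<Rightarrow> ('v \<Rightarrow> 'd) set" where
  "SOL D V C A = {x \<in> assignments D V. \<forall>S\<in>C. (S, restrict x S) \<in> A}"

text \<open>The vector space \<open>\<real>\<^sup>T\<close>, again as an extensional function space.\<close>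

definition wcsps :: "'d set \<Rightarrow> 'v set set \<Rightarrow> (('v, 'd) tuple \<Rightarrow> real) set" where
  "wcsps D C = (tuples D C \<rightarrow>\<^sub>E UNIV)"

definition phi :: "('v \<Rightarrow> 'd) \<Rightarrow> ('v, 'd) tuple \<Rightarrow> real" where
  "phi x = (\<lambda>(S, k). if restrict x S = k then 1 else 0)"

definition objective ::
  "'d set \<Rightarrow> 'v set set \<Rightarrow> (('v, 'd) tuple \<Rightarrow> real) \<Rightarrow> ('v \<Rightarrow> 'd) \<Rightarrow> real" where
  "objective D C f x = (\<Sum>t\<in>tuples D C. f t * phi x t)"

definition OPT ::
  "'d set \<Rightarrow> 'v set \<Rightarrow> 'v set set \<Rightarrow> (('v, 'd) tuple \<Rightarrow> real) \<Rightarrow> ('v \<Rightarrow> 'd) set" where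
  "OPT D V C f = {x. is_arg_max (objective D C f) (\<lambda>x. x \<in> assignments D V) x}"

definition super_reparametrization ::
  "'d set \<Rightarrow> 'v set \<Rightarrow> 'v set set \<Rightarrow> (('v, 'd) tuple \<Rightarrow> real) \<Rightarrow> (('v, 'd) tuple \<Rightarrow> real) \<Rightarrow> bool" where
  "super_reparametrization D V C f g \<longleftrightarrow>
     (\<forall>x\<in>assignments D V. objective D C f x \<ge> objective D C g x)"

definition upper_bound :: "'d set \<Rightarrow> 'v set set \<Rightarrow> (('v, 'd) tuple \<Rightarrow> real) \<Rightarrow> real" where
  "upper_bound D C f = (\<Sum>S\<in>C. Max (f ` scope_tuples D S))"

definition active_tuples ::
  "'d set \<Rightarrow> 'v set set \<Rightarrow> (('v, 'd) tuple \<Rightarrow> real) \<Rightarrow> ('v, 'd) tuple set" where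
  "active_tuples D C f = (\<Union>S\<in>C. {t \<in> scope_tuples D S. f t = Max (f ` scope_tuples D S)})"

end

theory Submission
  imports Defs
begin

text \<open>
  Let \<open>M\<close> be the maximum of the objective of \<open>g\<close>. The constant WCSP with value \<open>M / card C\<close> is a
  super-reparametrization of \<open>g\<close> with upper bound \<open>M\<close>, so \<open>B(f) \<le> M\<close>. On the other hand the
  objective of \<open>f\<close> never exceeds \<open>B(f)\<close>, with equality exactly on the solutions of \<open>A\<^sup>*(f)\<close>. At an
  optimal assignment of \<open>g\<close> the objective of \<open>f\<close> is at least \<open>M\<close>, hence \<open>B(f)\<close> is attained there.
\<close>

context
  fixes D :: "'d set" and V :: "'v set" and C :: "'v set set"
  assumes DVC: "structure_DVC D V C"
begin

lemma finite_scopes: "finite C"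
  using DVC unfolding structure_DVC_def by (meson finite_Pow_iff finite_subset)

lemma scope_tuples_image: "scope_tuples D S = Pair S ` (S \<rightarrow>\<^sub>E D)"
  unfolding scope_tuples_def by auto

lemma finite_scope_tuples:
  assumes "S \<in> C"
  shows "finite (scope_tuples D S)"
proof -
  have "finite S" "finite D"
    using assms DVC finite_subset[of S V] unfolding structure_DVC_def by auto
  then show ?thesis
    unfolding scope_tuples_image by (intro finite_imageI finite_PiE) auto
qed

lemma restrict_in_scope_tuples:
  assumes "x \<in> assignments D V" "S \<in> C"
  shows "(S, restrict x S) \<in> scope_tuples D S"
  using assms DVC unfolding structure_DVC_def assignments_def scope_tuples_def by auto

lemma finite_assignments: "finite (assignments D V)"
  using DVC unfolding structure_DVC_def assignments_def by (auto intro: finite_PiE)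

lemma assignments_nonempty: "assignments D V \<noteq> {}"
  using DVC unfolding structure_DVC_def assignments_def by (simp add: PiE_eq_empty_iff)

text \<open>Tuples carry their scope, so the sum over all tuples splits by scope; within one scope
  \<open>phi x\<close> vanishes except at the restriction of \<open>x\<close>.\<close>

lemma objective_eq_sum_scopes:
  assumes x: "x \<in> assignments D V"
  shows "objective D C f x = (\<Sum>S\<in>C. f (S, restrict x S))"
proof -
  have "objective D C f x = (\<Sum>S\<in>C. \<Sum>t\<in>scope_tuples D S. f t * phi x t)"
    unfolding objective_def tuples_def
    using finite_scopes finite_scope_tuples
    by (intro sum.UNION_disjoint) (auto simp: scope_tuples_def)
  also have "\<dots> = (\<Sum>S\<in>C. f (S, restrict x S))"
  proof (rule sum.cong[OF refl])
    fix S assume S: "S \<in> C"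
    have "(\<Sum>t\<in>scope_tuples D S. f t * phi x t)
        = (\<Sum>t\<in>scope_tuples D S. if t = (S, restrict x S) then f t else 0)"
      by (rule sum.cong) (auto simp: scope_tuples_def phi_def split: if_splits)
    also have "\<dots> = f (S, restrict x S)"
      using finite_scope_tuples[OF S] restrict_in_scope_tuples[OF x S] by simp
    finally show "(\<Sum>t\<in>scope_tuples D S. f t * phi x t) = f (S, restrict x S)" .
  qed
  finally show ?thesis .
qed

lemma le_Max_scope_tuples:
  fixes f :: "('v, 'd) tuple \<Rightarrow> real"
  assumes "x \<in> assignments D V" "S \<in> C"
  shows "f (S, restrict x S) \<le> Max (f ` scope_tuples D S)"
  using assms finite_scope_tuples restrict_in_scope_tuples by simp

lemma objective_le_upper_bound:
  assumes "x \<in> assignments D V"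
  shows "objective D C f x \<le> upper_bound D C f"
  unfolding objective_eq_sum_scopes[OF assms] upper_bound_def
  by (rule sum_mono) (rule le_Max_scope_tuples[OF assms])

lemma active_tuples_iff:
  assumes "x \<in> assignments D V" "S \<in> C"
  shows "(S, restrict x S) \<in> active_tuples D C f
    \<longleftrightarrow> f (S, restrict x S) = Max (f ` scope_tuples D S)"
  using restrict_in_scope_tuples[OF assms] assms(2)
  unfolding active_tuples_def scope_tuples_def by auto

text \<open>Both sides are finite sums over the scopes with termwise \<le>, so the sums agree only
  if every term does, that is, if every tuple of \<open>x\<close> is active.\<close>

lemma objective_eq_upper_bound_iff:
  assumes x: "x \<in> assignments D V"
  shows "objective D C f x = upper_bound D C f \<longleftrightarrow> x \<in> SOL D V C (active_tuples D C f)"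
proof -
  have "objective D C f x = upper_bound D C f
    \<longleftrightarrow> (\<forall>S\<in>C. f (S, restrict x S) = Max (f ` scope_tuples D S))"
    unfolding objective_eq_sum_scopes[OF x] upper_bound_def
    using sum_mono_inv[OF _ le_Max_scope_tuples[OF x] _ finite_scopes]
    by (auto intro: sum.cong)
  then show ?thesis
    using x by (simp add: SOL_def active_tuples_iff)
qed

lemma OPT_iff:
  "x \<in> OPT D V C f
    \<longleftrightarrow> x \<in> assignments D V \<and> (\<forall>y\<in>assignments D V. objective D C f y \<le> objective D C f x)"
  unfolding OPT_def is_arg_max_def by (auto simp: not_less)

text \<open>There are finitely many assignments, and at least one. An optimum of \<open>g\<close>
  will serve as the point where the bound of \<open>f\<close> is attained.\<close>

lemma OPT_nonempty: "OPT D V C f \<noteq> {}"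
proof -
  have "Max (objective D C f ` assignments D V) \<in> objective D C f ` assignments D V"
    using finite_assignments assignments_nonempty by (intro Max_in) auto
  then obtain x where "x \<in> assignments D V"
    "objective D C f x = Max (objective D C f ` assignments D V)"
    by auto
  then have "x \<in> OPT D V C f"
    using finite_assignments by (simp add: OPT_iff)
  then show ?thesis by auto
qed

lemma constant_super_reparametrization:
  assumes x: "x \<in> OPT D V C g"
  obtains h where "h \<in> wcsps D C" "super_reparametrization D V C h g"
    "upper_bound D C h = objective D C g x"
proof
  define c where "c = objective D C g x / card C"
  let ?h = "restrict (\<lambda>_. c) (tuples D C)"
  have xV: "x \<in> assignments D V" using x by (simp add: OPT_iff)
  \<comment> \<open>If \<open>C\<close> is empty, both sides are \<open>0\<close>.\<close>
  have sum_c: "(\<Sum>S\<in>C. c) = objective D C g x"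
    unfolding c_def using finite_scopes objective_eq_sum_scopes[OF xV, of g]
    by (cases "C = {}") simp_all
  have h: "?h t = c" if "S \<in> C" "t \<in> scope_tuples D S" for S t
    using that by (auto simp: tuples_def)
  show "?h \<in> wcsps D C" by (simp add: wcsps_def)
  have "objective D C ?h y = objective D C g x" if "y \<in> assignments D V" for y
    unfolding objective_eq_sum_scopes[OF that] sum_c[symmetric]
    using restrict_in_scope_tuples[OF that] h by (intro sum.cong) auto
  then show "super_reparametrization D V C ?h g"
    using x by (simp add: super_reparametrization_def OPT_iff)
  \<comment> \<open>The restriction of \<open>x\<close> shows that the image is nonempty, so
    \<open>Max\<close> really returns \<open>c\<close>.\<close>
  have "?h ` scope_tuples D S = {c}" if "S \<in> C" for S
  proof -
    have "?h ` scope_tuples D S = (\<lambda>_. c) ` scope_tuples D S"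
      using h[OF that] by (rule image_cong[OF refl])
    then show ?thesis
      using restrict_in_scope_tuples[OF xV that] by auto
  qed
  then show "upper_bound D C ?h = objective D C g x"
    by (simp add: upper_bound_def flip: sum_c)
qed

text \<open>A single assignment attaining the bound makes it the maximum of the objective; the
  optimal assignments are then exactly those that attain it.\<close>

lemma OPT_eq_SOL_active_tuples:
  assumes x: "x \<in> assignments D V" and tight: "objective D C f x = upper_bound D C f"
  shows "OPT D V C f = SOL D V C (active_tuples D C f)"
proof -
  have "y \<in> OPT D V C f \<longleftrightarrow> y \<in> assignments D V \<and> objective D C f y = upper_bound D C f" for y
    unfolding OPT_iff using x tight objective_le_upper_bound by (metis order_antisym)
  moreover have "y \<in> assignments D V" if "y \<in> SOL D V C A" for y A
    using that by (simp add: SOL_def)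
  ultimately show ?thesis using objective_eq_upper_bound_iff by blast
qed

end

theorem theorem9:
  fixes D :: "'d set" and V :: "'v set" and C :: "'v set set"
    and f g :: "('v, 'd) tuple \<Rightarrow> real"
  assumes "structure_DVC D V C"
    and "g \<in> wcsps D C"
    and "is_arg_min (upper_bound D C)
           (\<lambda>f'. f' \<in> wcsps D C \<and> super_reparametrization D V C f' g) f"
  shows "OPT D V C g \<subseteq> OPT D V C f \<and> OPT D V C f = SOL D V C (active_tuples D C f)"
proof -
  note DVC = assms(1)
  have tight: "x \<in> assignments D V \<and> objective D C f x = upper_bound D C f"
    if x: "x \<in> OPT D V C g" for x
  proof -
    have xV: "x \<in> assignments D V" using x by (simp add: OPT_iff[OF DVC])
    obtain h where "h \<in> wcsps D C" "super_reparametrization D V C h g"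
      "upper_bound D C h = objective D C g x"
      using constant_super_reparametrization[OF DVC x] .
    \<comment> \<open>Minimality of \<open>f\<close> is tested against the competitor
      \<open>h\<close>.\<close>
    then have "upper_bound D C f \<le> objective D C g x"
      using assms(3) by (force simp: is_arg_min_def not_less)
    also have "\<dots> \<le> objective D C f x"
      using assms(3) xV by (simp add: is_arg_min_def super_reparametrization_def)
    \<comment> \<open>The general bound on the objective of \<open>f\<close> closes the chain of
      inequalities, forcing equality.\<close>
    finally show ?thesis
      using xV objective_le_upper_bound[OF DVC xV] by (simp add: order_antisym)
  qed
  have "OPT D V C g \<subseteq> OPT D V C f"
    using tight objective_le_upper_bound[OF DVC] by (auto simp: OPT_iff[OF DVC])
  \<comment> \<open>The equality with \<open>SOL\<close> needs an actual assignment where the bound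
    is tight.\<close>
  moreover obtain x where "x \<in> OPT D V C g" using OPT_nonempty[OF DVC] by blast
  ultimately show ?thesis
    using tight OPT_eq_SOL_active_tuples[OF DVC] by blast
qed

end
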